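(* Let $D$ be any complex number and put $A=D-2$, $B=-3D+6$, $C=-D+3$. Then for all integers $m\ge0$ and $n\ge1$, $$\begin{aligned} &\frac1{(A_1^{(n)})^3}\sum_{\substack{k_1+k_2+k_3=m\\ k_1,k_2,k_3\ge0}}\binom{m}{k_1,k_2,k_3}U_{k_1}^{(n)}U_{k_2}^{(n)}U_{k_3}^{(n)}\\ &=\frac{A}{A_1^{(3n)}}3^mU_m^{(3n)}+\frac{B}{A_2^{(n)}}\sum_{k=0}^m\binom mk(-1)^kV_k^{(n)}\\ &\quad+\frac{C}{A_1^{(n)}A_1^{(2n)}}\sum_{k=0}^m\binom mkU_k^{(n)}2^{m-k}U_{m-k}^{(2n)}+\frac{D}{A_1^{(n)}}\sum_{k=0}^m\binom mkU_k^{(n)}t_{1,m-k}^{(n)}. \end{aligned}$$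
   Context: Let $\alpha,\beta,\gamma,\delta$ be the (distinct, complex) roots of $x^4-x^3-x^2-x-1=0$ and $c_1=\frac1{-\alpha^3+6\alpha-1}$, $c_2=\frac1{-\beta^3+6\beta-1}$, $c_3=\frac1{-\gamma^3+6\gamma-1}$, $c_4=\frac1{-\delta^3+6\delta-1}$. A Tetranacci-type sequence is one in which, from index $4$ on, each term is the sum of the four preceding terms. For each $n\ge1$, let $A_1^{(n)}$ be the nonzero rational number and $U_k^{(n)}=T_{1,k}^{(s_{1,0}^{(n)},s_{1,1}^{(n)},s_{1,2}^{(n)},s_{1,3}^{(n)})}$ the Tetranacci-type sequence with integer initial values $U_j^{(n)}=s_{1,j}^{(n)}$ ($0\le j\le3$) of greatest common divisor $1$ such that $$c_1^ne^{\alpha x}+c_2^ne^{\beta x}+c_3^ne^{\gamma x}+c_4^ne^{\delta x}=\frac1{A_1^{(n)}}\sum_{k=0}^\infty U_k^{(n)}\frac{x^k}{k!}.$$ Likewise let $A_2^{(n)}$ be the nonzero rational number and $V_k^{(n)}=T_{2,k}^{(s_{2,0}^{(n)},s_{2,1}^{(n)},s_{2,2}^{(n)},s_{2,3}^{(n)})}$ the Tetranacci-type sequence with integer initial values $V_j^{(n)}=s_{2,j}^{(n)}$ ($0\le j\le3$) of greatest common divisor $1$ such that $$c_2^nc_3^nc_4^ne^{\alpha x}+c_1^nc_3^nc_4^ne^{\beta x}+c_1^nc_2^nc_4^ne^{\gamma x}+c_1^nc_2^nc_3^ne^{\delta x}=\frac1{A_2^{(n)}}\sum_{k=0}^\infty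 V_k^{(n)}\frac{x^k}{k!}.$$ The signs are fixed by requiring $U_k^{(n)}>0$ and $V_k^{(n)}>0$ for all sufficiently large $k$. Put $$t_{1,m}^{(n)}=\frac12\left(\frac1{(A_1^{(n)})^2}\sum_{k=0}^m\binom mkU_k^{(n)}U_{m-k}^{(n)}-\frac{2^m}{A_1^{(2n)}}U_m^{(2n)}\right),$$ equivalently $\sum_{m\ge0}t_{1,m}^{(n)}\frac{x^m}{m!}=c_1^nc_2^ne^{(\alpha+\beta)x}+c_1^nc_3^ne^{(\alpha+\gamma)x}+c_1^nc_4^ne^{(\alpha+\delta)x}+c_2^nc_3^ne^{(\beta+\gamma)x}+c_2^nc_4^ne^{(\beta+\delta)x}+c_3^nc_4^ne^{(\gamma+\delta)x}$. Superscripts $(n)$ are indices; $c_i^n$ is an $n$-th power. $\binom{m}{k_1,\dots,k_r}=\frac{m!}{k_1!\cdots k_r!}$. *)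

theory Defs
  imports Complex_Main
begin

definition tetranacci_type :: "(nat \<Rightarrow> int) \<Rightarrow> bool" where
  "tetranacci_type U \<longleftrightarrow> (\<forall>k\<ge>4. U k = U (k - 1) + U (k - 2) + U (k - 3) + U (k - 4))"

definition tetra_coeff :: "complex \<Rightarrow> complex" where
  "tetra_coeff r = 1 / (- (r ^ 3) + 6 * r - 1)"

text \<open>
  \<^term>\<open>F\<close> is the exponential generating function of \<^term>\<open>U\<close> divided by \<^term>\<open>A\<close>.
  The gcd condition determines the pair of \<^term>\<open>A\<close> and \<^term>\<open>U\<close> up to a common sign,
  which eventual positivity then fixes.
\<close>

definition normalized_egf :: "(complex \<Rightarrow> complex) \<Rightarrow> rat \<Rightarrow> (nat \<Rightarrow> int) \<Rightarrow> bool" where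
  "normalized_egf F A U \<longleftrightarrow>
     A \<noteq> 0 \<and>
     tetranacci_type U \<and>
     Gcd {U 0, U 1, U 2, U 3} = 1 \<and>
     (\<forall>\<^sub>F k in sequentially. U k > 0) \<and>
     (\<forall>x. (\<lambda>k. 1 / of_rat A * (of_int (U k) * x ^ k / fact k)) sums F x)"

text \<open>
  In the families below the first argument is the superscript: \<^term>\<open>U n k\<close> is the
  \<^term>\<open>k\<close>-th term of the sequence attached to the \<^term>\<open>n\<close>-th powers of the coefficients.
\<close>

definition t1 :: "(nat \<Rightarrow> rat) \<Rightarrow> (nat \<Rightarrow> nat \<Rightarrow> int) \<Rightarrow> nat \<Rightarrow> nat \<Rightarrow> rat" where
  "t1 A1 U n m =
     1 / 2 * (1 / (A1 n) ^ 2 * (\<Sum>k=0..m. of_nat (m choose k) * of_int (U n k) * of_int (U n (m - k)))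
              - 2 ^ m / A1 (2 * n) * of_int (U (2 * n) m))"

end

theory Submission
  imports Defs "HOL-Analysis.FPS_Convergence"
begin

text \<open>
  Let \<open>X\<^sub>i = c\<^sub>i ^ n * exp (r\<^sub>i * x)\<close> as a formal power series in \<open>x\<close>, where
  \<open>r\<^sub>1, \<dots>, r\<^sub>4\<close> are the four roots, and let \<open>p\<^sub>j\<close> and \<open>e\<^sub>j\<close> be the power sums and the
  elementary symmetric functions of \<open>X\<^sub>1, \<dots>, X\<^sub>4\<close>. Every sum in the theorem, with the
  normalizing factors \<open>1 / A1\<close> and \<open>1 / A2\<close> put into \<open>U\<close> and \<open>V\<close>, is \<open>m!\<close> times a coefficient
  of a polynomial in these:

  \<^item> Since \<open>X\<^sub>i ^ j = c\<^sub>i ^ (j * n) * exp (j * r\<^sub>i * x)\<close>, the sequence with superscript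
    \<open>j * n\<close>, its \<open>k\<close>-th term multiplied by \<open>j ^ k\<close>, has the exponential
    generating function \<open>p\<^sub>j\<close>.
  \<^item> The numbers \<open>t1\<close> belong to \<open>(p\<^sub>1\<^sup>2 - p\<^sub>2) / 2 = e\<^sub>2\<close>.
  \<^item> The sum over \<open>V\<close> belongs to \<open>e\<^sub>3\<close>. The roots add up to \<open>1\<close>, so the product of all \<open>X\<^sub>i\<close> but
    \<open>X\<^sub>j\<close> contains the exponential \<open>exp ((1 - r\<^sub>j) * x)\<close>. The signs turn \<open>exp (r\<^sub>j * x)\<close> into
    \<open>exp (- r\<^sub>j * x)\<close>, and a binomial convolution with the constant sequence \<open>1\<close> multiplies
    this by \<open>exp x\<close>.

  The theorem is then the coefficient form of
  \<open>p\<^sub>1 ^ 3 = A * p\<^sub>3 + B * e\<^sub>3 + C * p\<^sub>1 * p\<^sub>2 + D * p\<^sub>1 * e\<^sub>2\<close>, a consequence of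
  \<open>p\<^sub>1 * p\<^sub>2 = p\<^sub>1 ^ 3 - 2 * p\<^sub>1 * e\<^sub>2\<close> and \<open>p\<^sub>3 = p\<^sub>1 ^ 3 - 3 * p\<^sub>1 * e\<^sub>2 + 3 * e\<^sub>3\<close>. Comparing the
  coefficients of \<open>p\<^sub>1 ^ 3\<close>, \<open>p\<^sub>1 * e\<^sub>2\<close> and \<open>e\<^sub>3\<close> gives three independent linear equations for
  \<open>A, B, C, D\<close>; this is why one parameter remains free.

  The lemma \<open>normalized_egf_imp_egf_eq\<close> turns the analytic hypotheses into identities of formal power
  series, \<open>egf_mult\<close>, \<open>egf_mult3\<close> and \<open>egf_scale\<close> translate the sums,
  \<open>sum_of_roots_tetranacci\<close> supplies the sum of the roots, and \<open>cube_of_sum_of_four\<close> is the symmetric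
  function identity.
\<close>

section \<open>Exponential generating functions\<close>

definition egf :: "(nat \<Rightarrow> 'a) \<Rightarrow> 'a::field_char_0 fps" where
  "egf u = Abs_fps (\<lambda>k. u k / fact k)"

lemma egf_nth [simp]: "fps_nth (egf u) k = u k / fact k"
  by (simp add: egf_def)

lemma egf_one: "egf (\<lambda>_. 1) = fps_exp 1"
  by (simp add: fps_eq_iff)

lemma egf_mult:
  "egf u * egf v = egf (\<lambda>m. \<Sum>k=0..m. of_nat (m choose k) * u k * v (m - k))"
proof (rule fps_ext)
  fix m
  have "fps_nth (egf u * egf v) m = (\<Sum>k=0..m. (of_nat (m choose k) * u k * v (m - k)) / fact m)"
    unfolding fps_mult_nth
    by (intro sum.cong refl) (simp add: binomial_fact field_simps)
  then show "fps_nth (egf u * egf v) m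
      = fps_nth (egf (\<lambda>m. \<Sum>k=0..m. of_nat (m choose k) * u k * v (m - k))) m"
    by (simp add: sum_divide_distrib)
qed

lemma egf_mult3:
  "egf u * egf v * egf w = egf (\<lambda>m. \<Sum>(k1, k2, k3) \<in> {(k1, k2, k3). k1 + k2 + k3 = m}.
      fact m / (fact k1 * fact k2 * fact k3) * u k1 * v k2 * w k3)"
proof (rule fps_ext)
  fix m
  have "fps_nth (egf u * egf v * egf w) m
      = (\<Sum>i=0..m. \<Sum>j=0..i. u j / fact j * (v (i - j) / fact (i - j)) * (w (m - i) / fact (m - i)))"
    by (simp only: fps_mult_nth egf_nth sum_distrib_right)
  also have "\<dots> = (\<Sum>(i, j) \<in> Sigma {0..m} (\<lambda>i. {0..i}).
      u j / fact j * (v (i - j) / fact (i - j)) * (w (m - i) / fact (m - i)))"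
    by (rule sum.Sigma) auto
  also have "\<dots> = (\<Sum>(k1, k2, k3) \<in> {(k1, k2, k3). k1 + k2 + k3 = m}.
      (fact m / (fact k1 * fact k2 * fact k3) * u k1 * v k2 * w k3) / fact m)"
    by (rule sum.reindex_bij_witness[where j = "\<lambda>(i, j). (j, i - j, m - i)"
          and i = "\<lambda>(k1, k2, k3). (k1 + k2, k1)"]) (auto simp: mult_ac)
  finally show "fps_nth (egf u * egf v * egf w) m
      = fps_nth (egf (\<lambda>m. \<Sum>(k1, k2, k3) \<in> {(k1, k2, k3). k1 + k2 + k3 = m}.
          fact m / (fact k1 * fact k2 * fact k3) * u k1 * v k2 * w k3)) m"
    by (simp add: sum_divide_distrib case_prod_unfold)
qed

lemma egf_scale: "egf (\<lambda>k. c ^ k * u k) = egf u oo (fps_const c * fps_X)"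
  by (simp add: fps_eq_iff fps_compose_linear)

text \<open>
  An everywhere convergent power series has positive radius of convergence, so its coefficients are
  determined by the function near the origin.
\<close>

lemma egf_eqI:
  fixes u :: "nat \<Rightarrow> complex"
  assumes "\<And>x. (\<lambda>k. u k / fact k * x ^ k) sums F x" and "F has_fps_expansion G"
  shows "egf u = G"
proof (rule eval_fps_eqD)
  \<comment> \<open>Convergence at the single point \<open>1\<close> bounds the radius away from \<open>0\<close>.\<close>
  have "1 \<le> fps_conv_radius (egf u)"
    unfolding fps_conv_radius_def
    using conv_radius_geI[of "fps_nth (egf u)" 1] assms(1)[of 1]
    by (simp add: sums_iff one_ereal_def)
  then show "0 < fps_conv_radius (egf u)"
    by (rule less_le_trans[rotated]) simp
  show "0 < fps_conv_radius G"
    using assms(2) by (simp add: has_fps_expansion_def)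
  have "eval_fps (egf u) x = F x" for x
    using assms(1)[of x] by (simp add: eval_fps_def sums_iff)
  then show "\<forall>\<^sub>F z in nhds 0. eval_fps (egf u) z = eval_fps G z"
    using assms(2) by (simp add: has_fps_expansion_def eq_commute)
qed

lemma normalized_egf_imp_egf_eq:
  assumes "normalized_egf F A U" and "F has_fps_expansion G"
  shows "egf (\<lambda>k. of_int (U k) / of_rat A) = G"
proof (rule egf_eqI[OF _ assms(2)])
  show "(\<lambda>k. of_int (U k) / of_rat A / fact k * x ^ k) sums F x" for x
    using assms(1) by (simp add: normalized_egf_def mult_ac)
qed

section \<open>The roots and the symmetric function identity\<close>

text \<open>
  Each step divides out one difference of roots, which amounts to passing to the next divided
  difference of the polynomial; the third one is linear and equals \<open>a + b + c + d - 1\<close>.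
\<close>

lemma sum_of_roots_tetranacci:
  fixes a b c d :: "'a::idom"
  assumes "{a, b, c, d} = {x. x ^ 4 - x ^ 3 - x ^ 2 - x - 1 = 0}" and "distinct [a, b, c, d]"
  shows "a + b + c + d = 1"
proof -
  have root: "x ^ 4 - x ^ 3 - x ^ 2 - x - 1 = 0" if "x \<in> {a, b, c, d}" for x
    using that assms(1) by blast
  have first: "a^3 + a^2 * y + a * y^2 + y^3 - (a^2 + a * y + y^2) - (a + y) - 1 = 0"
    if "y \<in> {b, c, d}" for y
  proof -
    have "(a - y) * (a^3 + a^2 * y + a * y^2 + y^3 - (a^2 + a * y + y^2) - (a + y) - 1) = 0"
      using root[OF insertI1] root[OF insertI2[OF that]] by algebra
    then show ?thesis using that assms(2) by auto
  qed
  have second: "a^2 + b^2 + y^2 + a * b + a * y + b * y - (a + b + y) - 1 = 0"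
    if "y \<in> {c, d}" for y
  proof -
    have "(b - y) * (a^2 + b^2 + y^2 + a * b + a * y + b * y - (a + b + y) - 1) = 0"
      using first[OF insertI1] first[OF insertI2[OF that]] by algebra
    then show ?thesis using that assms(2) by auto
  qed
  have "(c - d) * (a + b + c + d - 1) = 0"
    using second[OF insertI1] second[OF insertI2[OF singletonI]] by algebra
  then show ?thesis using assms(2) by auto
qed

lemma cube_of_sum_of_four:
  fixes x y z w d :: "'a::comm_ring_1"
  shows "(x + y + z + w) ^ 3
    = (d - 2) * (x^3 + y^3 + z^3 + w^3)
      + (- 3 * d + 6) * (y * z * w + x * z * w + x * y * w + x * y * z)
      + (- d + 3) * ((x + y + z + w) * (x^2 + y^2 + z^2 + w^2))
      + d * ((x + y + z + w) * (x * y + x * z + x * w + y * z + y * w + z * w))"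
  by (simp add: algebra_simps power2_eq_square power3_eq_cube)

section \<open>Cubic convolution of Tetranacci-type sequences\<close>

theorem theorem13:
  fixes \<alpha> \<beta> \<gamma> \<delta> c1 c2 c3 c4 A B C D :: complex
    and A1 A2 :: "nat \<Rightarrow> rat"
    and U V :: "nat \<Rightarrow> nat \<Rightarrow> int"
    and m n :: nat
  assumes roots: "{\<alpha>, \<beta>, \<gamma>, \<delta>} = {x. x ^ 4 - x ^ 3 - x ^ 2 - x - 1 = 0}"
    and dist: "distinct [\<alpha>, \<beta>, \<gamma>, \<delta>]"
    and c: "c1 = tetra_coeff \<alpha>" "c2 = tetra_coeff \<beta>" "c3 = tetra_coeff \<gamma>" "c4 = tetra_coeff \<delta>"
    and U: "\<And>j. j \<ge> 1 \<Longrightarrow> normalized_egf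
              (\<lambda>x. c1 ^ j * exp (\<alpha> * x) + c2 ^ j * exp (\<beta> * x)
                 + c3 ^ j * exp (\<gamma> * x) + c4 ^ j * exp (\<delta> * x))
              (A1 j) (U j)"
    and V: "\<And>j. j \<ge> 1 \<Longrightarrow> normalized_egf
              (\<lambda>x. c2 ^ j * c3 ^ j * c4 ^ j * exp (\<alpha> * x) + c1 ^ j * c3 ^ j * c4 ^ j * exp (\<beta> * x)
                 + c1 ^ j * c2 ^ j * c4 ^ j * exp (\<gamma> * x) + c1 ^ j * c2 ^ j * c3 ^ j * exp (\<delta> * x))
              (A2 j) (V j)"
    and A: "A = D - 2" and B: "B = - 3 * D + 6" and C: "C = - D + 3"
    and n: "n \<ge> 1"
  shows "1 / of_rat (A1 n) ^ 3 *
           (\<Sum>(k1, k2, k3) \<in> {(k1, k2, k3). k1 + k2 + k3 = m}.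
              fact m / (fact k1 * fact k2 * fact k3)
                * of_int (U n k1) * of_int (U n k2) * of_int (U n k3))
         = A / of_rat (A1 (3 * n)) * 3 ^ m * of_int (U (3 * n) m)
         + B / of_rat (A2 n) * (\<Sum>k=0..m. of_nat (m choose k) * (- 1) ^ k * of_int (V n k))
         + C / (of_rat (A1 n) * of_rat (A1 (2 * n)))
             * (\<Sum>k=0..m. of_nat (m choose k) * of_int (U n k)
                           * 2 ^ (m - k) * of_int (U (2 * n) (m - k)))
         + D / of_rat (A1 n)
             * (\<Sum>k=0..m. of_nat (m choose k) * of_int (U n k) * of_rat (t1 A1 U n (m - k)))"
proof -
  define u where "u = (\<lambda>j k. of_int (U j k) / of_rat (A1 j) :: complex)"
  define v where "v = (\<lambda>k. of_int (V n k) / of_rat (A2 n) :: complex)"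
  define X1 where "X1 = fps_const (c1 ^ n) * fps_exp \<alpha>"
  define X2 where "X2 = fps_const (c2 ^ n) * fps_exp \<beta>"
  define X3 where "X3 = fps_const (c3 ^ n) * fps_exp \<gamma>"
  define X4 where "X4 = fps_const (c4 ^ n) * fps_exp \<delta>"
  note X_defs = X1_def X2_def X3_def X4_def

  have root_sum: "\<alpha> + \<beta> + \<gamma> + \<delta> = 1"
    by (rule sum_of_roots_tetranacci[OF roots dist])

  have egf_u: "egf (u j) = fps_const (c1 ^ j) * fps_exp \<alpha> + fps_const (c2 ^ j) * fps_exp \<beta>
      + fps_const (c3 ^ j) * fps_exp \<gamma> + fps_const (c4 ^ j) * fps_exp \<delta>" if "j \<ge> 1" for j
    unfolding u_def
    by (rule normalized_egf_imp_egf_eq[OF U[OF that]]) (intro fps_expansion_intros)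
  have egf_v: "egf v = fps_const (c2 ^ n * c3 ^ n * c4 ^ n) * fps_exp \<alpha>
      + fps_const (c1 ^ n * c3 ^ n * c4 ^ n) * fps_exp \<beta>
      + fps_const (c1 ^ n * c2 ^ n * c4 ^ n) * fps_exp \<gamma>
      + fps_const (c1 ^ n * c2 ^ n * c3 ^ n) * fps_exp \<delta>"
    unfolding v_def
    by (rule normalized_egf_imp_egf_eq[OF V[OF n]]) (intro fps_expansion_intros)

  have p1: "egf (u n) = X1 + X2 + X3 + X4"
    using n by (simp add: egf_u X_defs)
  have power_sum: "egf (\<lambda>k. of_nat j ^ k * u (j * n) k) = X1 ^ j + X2 ^ j + X3 ^ j + X4 ^ j"
    if "j \<ge> 1" for j
  proof -
    have "j * n \<ge> 1" using that n by simp
    then show ?thesis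
      unfolding egf_scale X_defs
      by (simp add: egf_u fps_compose_add_distrib fps_compose_mult_distrib power_mult_distrib
          fps_exp_power_mult fps_const_power power_mult[symmetric] mult.commute[of n]
          mult.commute[of _ "of_nat j"])
  qed
  have p2: "egf (\<lambda>k. 2 ^ k * u (2 * n) k) = X1 ^ 2 + X2 ^ 2 + X3 ^ 2 + X4 ^ 2"
    using power_sum[of 2] by simp
  have p3: "egf (\<lambda>k. 3 ^ k * u (3 * n) k) = X1 ^ 3 + X2 ^ 3 + X3 ^ 3 + X4 ^ 3"
    using power_sum[of 3] by simp

  have e2: "egf (\<lambda>k. of_rat (t1 A1 U n k))
      = X1 * X2 + X1 * X3 + X1 * X4 + X2 * X3 + X2 * X4 + X3 * X4" (is "?t = ?e2")
  proof -
    have "2 * of_rat (t1 A1 U n k)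
        = (\<Sum>i=0..k. of_nat (k choose i) * u n i * u n (k - i)) - 2 ^ k * u (2 * n) k" for k
      by (simp add: t1_def u_def of_rat_mult of_rat_diff of_rat_divide of_rat_power of_rat_sum
          sum_distrib_left sum_divide_distrib power2_eq_square mult_ac)
    then have "of_rat (t1 A1 U n k)
        = ((\<Sum>i=0..k. of_nat (k choose i) * u n i * u n (k - i)) - 2 ^ k * u (2 * n) k) / 2" for k
      by (metis nonzero_mult_div_cancel_left zero_neq_numeral)
    then have "?t = fps_const (1 / 2) * (egf (u n) * egf (u n) - egf (\<lambda>k. 2 ^ k * u (2 * n) k))"
      by (simp add: egf_mult fps_eq_iff field_simps)
    also have "\<dots> = fps_const (1 / 2) * (2 * ?e2)"
      unfolding p1 p2 by (simp add: algebra_simps power2_eq_square)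
    also have "\<dots> = ?e2"
      by (simp add: fps_numeral_fps_const flip: mult.assoc)
    finally show ?thesis .
  qed

  have e3: "egf (\<lambda>m. \<Sum>k=0..m. of_nat (m choose k) * ((- 1) ^ k * v k))
      = X2 * X3 * X4 + X1 * X3 * X4 + X1 * X2 * X4 + X1 * X2 * X3" (is "?s = ?e3")
  proof -
    \<comment> \<open>The factor \<open>fps_exp 1\<close> carries the sum of the roots, so it cancels one exponential
      and leaves the other three.\<close>
    have complement: "fps_exp 1 * fps_exp (- a) = fps_exp b * fps_exp c * fps_exp d"
      if "a + b + c + d = 1" for a b c d :: complex
    proof -
      have "1 + - a = b + c + d" using that by (simp add: algebra_simps)
      then show ?thesis by (simp flip: fps_exp_add_mult)
    qed
    have "?s = egf (\<lambda>k. (- 1) ^ k * v k) * egf (\<lambda>_. 1)"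
      by (simp add: egf_mult mult.assoc)
    also have "\<dots> = fps_const (c2 ^ n * c3 ^ n * c4 ^ n) * (fps_exp 1 * fps_exp (- \<alpha>))
      + fps_const (c1 ^ n * c3 ^ n * c4 ^ n) * (fps_exp 1 * fps_exp (- \<beta>))
      + fps_const (c1 ^ n * c2 ^ n * c4 ^ n) * (fps_exp 1 * fps_exp (- \<gamma>))
      + fps_const (c1 ^ n * c2 ^ n * c3 ^ n) * (fps_exp 1 * fps_exp (- \<delta>))"
      unfolding egf_scale egf_one egf_v
      by (simp add: fps_compose_add_distrib fps_compose_mult_distrib del: fps_const_neg)
        (simp add: algebra_simps)
    also have "\<dots> = fps_const (c2 ^ n * c3 ^ n * c4 ^ n) * (fps_exp \<beta> * fps_exp \<gamma> * fps_exp \<delta>)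
      + fps_const (c1 ^ n * c3 ^ n * c4 ^ n) * (fps_exp \<alpha> * fps_exp \<gamma> * fps_exp \<delta>)
      + fps_const (c1 ^ n * c2 ^ n * c4 ^ n) * (fps_exp \<alpha> * fps_exp \<beta> * fps_exp \<delta>)
      + fps_const (c1 ^ n * c2 ^ n * c3 ^ n) * (fps_exp \<alpha> * fps_exp \<beta> * fps_exp \<gamma>)"
      using complement[of \<alpha> \<beta> \<gamma> \<delta>] complement[of \<beta> \<alpha> \<gamma> \<delta>]
        complement[of \<gamma> \<alpha> \<beta> \<delta>] complement[of \<delta> \<alpha> \<beta> \<gamma>] root_sum
      by (simp add: add_ac)
    also have "\<dots> = ?e3"
      unfolding X_defs fps_const_mult[symmetric] by (simp only: mult_ac)
    finally show ?thesis .
  qed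

  have "egf (u n) * egf (u n) * egf (u n)
      = fps_const A * egf (\<lambda>k. 3 ^ k * u (3 * n) k)
        + fps_const B * egf (\<lambda>m. \<Sum>k=0..m. of_nat (m choose k) * ((- 1) ^ k * v k))
        + fps_const C * (egf (u n) * egf (\<lambda>k. 2 ^ k * u (2 * n) k))
        + fps_const D * (egf (u n) * egf (\<lambda>k. of_rat (t1 A1 U n k)))"
  proof -
    have ABC: "fps_const A = fps_const D - 2" "fps_const B = - 3 * fps_const D + 6"
      "fps_const C = - fps_const D + 3"
      by (simp_all add: A B C fps_numeral_fps_const)
    show ?thesis
      unfolding p1 p2 p3 e2 e3 ABC power3_eq_cube[of "X1 + X2 + X3 + X4", symmetric]
      by (rule cube_of_sum_of_four)
  qed
  from arg_cong[where f = "\<lambda>F. fps_nth F m", OF this]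
  have "(\<Sum>(k1, k2, k3) \<in> {(k1, k2, k3). k1 + k2 + k3 = m}.
        fact m / (fact k1 * fact k2 * fact k3) * u n k1 * u n k2 * u n k3)
      = A * (3 ^ m * u (3 * n) m)
        + B * (\<Sum>k=0..m. of_nat (m choose k) * ((- 1) ^ k * v k))
        + C * (\<Sum>k=0..m. of_nat (m choose k) * u n k * (2 ^ (m - k) * u (2 * n) (m - k)))
        + D * (\<Sum>k=0..m. of_nat (m choose k) * u n k * of_rat (t1 A1 U n (m - k)))"
    unfolding egf_mult3 unfolding egf_mult by (simp flip: add_divide_distrib)
  then show ?thesis
    by (simp add: u_def v_def sum_distrib_left case_prod_unfold power3_eq_cube divide_inverse mult_ac)
qed

end
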